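(* Let $\mathcal X\in\mathrm{Gr}(n,k)$ and let $0\le\theta_1\le\cdots\le\theta_k<\pi/2$ be the principal angles between $\mathcal X$ and $\mathcal V_\alpha$. Then $$f(\mathcal X)-f^*\le\frac1{a(\mathcal X)}\langle\mathrm{grad}f(\mathcal X),-\mathrm{Log}_{\mathcal X}(\mathcal V_\alpha)\rangle-c_Q\,\delta\,\mathrm{dist}^2(\mathcal X,\mathcal V_\alpha),$$ where $a(\mathcal X)=\theta_k/\tan\theta_k>0$, $c_Q=4/\pi^2>0.4$ and $\delta=\lambda_k-\lambda_{k+1}\ge0$.
   Context: Let $1\le k\le n-1$ and let $A\in\mathbb R^{n\times n}$ be symmetric positive semidefinite with eigenvalues $\lambda_1\ge\cdots\ge\lambda_n$ (with multiplicity) and orthonormal eigenvectors $v_1,\dots,v_n$, $Av_i=\lambda_iv_i$. Put $\mathcal V_\alpha=\mathrm{span}(v_1,\dots,v_k)$ (if $\lambda_k=\lambda_{k+1}$, $\mathcal V_\alpha$ is any fixed subspace spanned by $k$ leading eigenvectors). Convention: $\frac{0}{\tan0}=1$. $\mathrm{Gr}(n,k)$ is the Grassmann manifold of $k$-dimensional subspaces of $\mathbb R^n$; a subspace $\mathcal X=\mathrm{span}(X)$ is always represented by $X\in\mathbb R^{n\times k}$ with $X^TX=I_k$. Tangent vectors at $\mathcal X$ (for a given representative $X$) are the $G\in\mathbb R^{n\times k}$ with $X^TG=0$; the Riemannian metric is $\langle G_1,G_2\rangle=\mathrm{Tr}(G_1^TG_2)$, both tangent vectors being taken with respect to the same $X$.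 The principal angles $0\le\theta_1\le\cdots\le\theta_k\le\pi/2$ between $\mathcal X=\mathrm{span}(X)$ and $\mathcal Y=\mathrm{span}(Y)$ are such that $\cos\theta_1,\dots,\cos\theta_k$ are the singular values of $Y^TX$; the Riemannian distance is $\mathrm{dist}(\mathcal X,\mathcal Y)=\sqrt{\theta_1^2+\cdots+\theta_k^2}$. If all principal angles are $<\pi/2$, the Riemannian logarithm is $\mathrm{Log}_{\mathcal X}(\mathcal Y)=U\arctan(\widehat\Sigma)V^T$, where $U\widehat\Sigma V^T=(I-XX^T)Y(X^TY)^{-1}$ is a compact SVD. The objective is $f:\mathrm{Gr}(n,k)\to\mathbb R$, $f(\mathcal X)=-\mathrm{Tr}(X^TAX)$, with Riemannian gradient $\mathrm{grad}f(\mathcal X)=-2(I-XX^T)AX$ and global minimum $f^*=-(\lambda_1+\cdots+\lambda_k)$. *)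

theory Defs
  imports
    Complex_Main
    "Jordan_Normal_Form.Gauss_Jordan_Elimination"
    "Jordan_Normal_Form.VS_Connect"
begin

text \<open>Points of the Grassmann manifold of k-dimensional subspaces of n-space are given by n x k
  representatives with orthonormal columns. Functions of subspaces are functions of such
  representatives below.\<close>

definition Gr_rep :: "nat \<Rightarrow> nat \<Rightarrow> real mat set" where
  "Gr_rep n k = {X \<in> carrier_mat n k. X\<^sup>T * X = 1\<^sub>m k}"

definition col_span :: "real mat \<Rightarrow> real vec set" where
  "col_span X = vec_space.col_space (dim_row X) X"

definition vec_span :: "nat \<Rightarrow> real vec set \<Rightarrow> real vec set" where
  "vec_span n S = LinearCombinations.module.span class_ring (module_vec TYPE(real) n) S"

definition mat_trace :: "real mat \<Rightarrow> real" where
  "mat_trace M = (\<Sum>i<dim_row M. M $$ (i, i))"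

definition positive_semidefinite :: "real mat \<Rightarrow> bool" where
  "positive_semidefinite A \<longleftrightarrow>
     (\<forall>x \<in> carrier_vec (dim_row A). 0 \<le> x \<bullet> (A *\<^sub>v x))"

text \<open>A singular value decomposition of \<open>M\<close> with \<open>r\<close> retained singular values \<open>s 0, ..., s (r - 1)\<close>.
  For an m x p matrix, \<open>r = min m p\<close> is the thin form and \<open>r = rank M\<close> the form with positive
  singular values only; intermediate \<open>r\<close> are allowed too. No order is imposed on \<open>s\<close>.\<close>

definition is_svd :: "nat \<Rightarrow> real mat \<Rightarrow> real mat \<Rightarrow> (nat \<Rightarrow> real) \<Rightarrow> real mat \<Rightarrow> bool" where
  "is_svd r M U s V \<longleftrightarrow>
     U \<in> carrier_mat (dim_row M) r \<and> U\<^sup>T * U = 1\<^sub>m r \<and>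
     V \<in> carrier_mat (dim_col M) r \<and> V\<^sup>T * V = 1\<^sub>m r \<and>
     (\<forall>i<r. 0 \<le> s i) \<and>
     M = U * mat_diag r s * V\<^sup>T"

text \<open>The angles are numbered \<open>\<theta> 1 \<le> ... \<le> \<theta> k\<close>, whereas matrix indices start at 0.\<close>

definition principal_angles :: "real mat \<Rightarrow> real mat \<Rightarrow> (nat \<Rightarrow> real) \<Rightarrow> bool" where
  "principal_angles X Y \<theta> \<longleftrightarrow>
     (let k = dim_col X in
       (\<forall>i\<in>{1..k}. 0 \<le> \<theta> i \<and> \<theta> i \<le> pi / 2) \<and>
       (\<forall>i\<in>{1..k}. \<forall>j\<in>{1..k}. i \<le> j \<longrightarrow> \<theta> i \<le> \<theta> j) \<and>
       (\<exists>P Q. is_svd k (Y\<^sup>T * X) P (\<lambda>i. cos (\<theta> (Suc i))) Q))"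

definition Gr_dist :: "real mat \<Rightarrow> real mat \<Rightarrow> real" where
  "Gr_dist X Y =
     (THE d. \<exists>\<theta>. principal_angles X Y \<theta> \<and> d = sqrt (\<Sum>i=1..dim_col X. (\<theta> i)\<^sup>2))"

text \<open>The value does not depend on the chosen decomposition, nor on \<open>r\<close>, since \<open>arctan 0 = 0\<close>.
  It is meaningful only if all principal angles between \<open>X\<close> and \<open>Y\<close> are less than \<open>pi / 2\<close>, i.e. if
  \<open>X\<^sup>T * Y\<close> is invertible.\<close>

definition Gr_Log :: "real mat \<Rightarrow> real mat \<Rightarrow> real mat" where
  "Gr_Log X Y =
     (THE L. \<exists>r U s V.
        is_svd r ((1\<^sub>m (dim_row X) - X * X\<^sup>T) * Y * the (mat_inverse (X\<^sup>T * Y))) U s V \<and>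
        L = U * mat_diag r (\<lambda>i. arctan (s i)) * V\<^sup>T)"

definition Gr_inner :: "real mat \<Rightarrow> real mat \<Rightarrow> real" where
  "Gr_inner G\<^sub>1 G\<^sub>2 = mat_trace (G\<^sub>1\<^sup>T * G\<^sub>2)"

definition objective :: "real mat \<Rightarrow> real mat \<Rightarrow> real" where
  "objective A X = - mat_trace (X\<^sup>T * A * X)"

definition grad_objective :: "real mat \<Rightarrow> real mat \<Rightarrow> real mat" where
  "grad_objective A X = (-2) \<cdot>\<^sub>m ((1\<^sub>m (dim_row X) - X * X\<^sup>T) * A * X)"

text \<open>The quotient \<open>t / tan t\<close>, extended by its limit 1 at 0.\<close>

definition over_tan :: "real \<Rightarrow> real" where
  "over_tan t = (if t = 0 then 1 else t / tan t)"

end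

theory Submission
  imports Defs
begin

text \<open>Choose representatives whose columns are principal vectors: if \<open>Y\<^sup>T X = P (diag cos \<alpha>) Q\<^sup>T\<close>, then
  the columns \<open>x\<^sub>i\<close> of \<open>X Q\<close> and \<open>y\<^sub>i\<close> of \<open>Y P\<close> satisfy \<open>x\<^sub>i = cos \<alpha>\<^sub>i y\<^sub>i + sin \<alpha>\<^sub>i z\<^sub>i\<close> with unit vectors \<open>z\<^sub>i\<close>
  orthogonal to the leading eigenspace. Since that eigenspace is invariant under \<open>A\<close>, mixed terms
  vanish, and the numbers \<open>e\<^sub>i = y\<^sub>i \<bullet> A y\<^sub>i - x\<^sub>i \<bullet> A x\<^sub>i = sin\<^sup>2 \<alpha>\<^sub>i (y\<^sub>i \<bullet> A y\<^sub>i - z\<^sub>i \<bullet> A z\<^sub>i)\<close> are at least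
  \<open>\<delta> sin\<^sup>2 \<alpha>\<^sub>i\<close>, hence nonnegative (\<open>eigenvalue_gap_bound\<close>).

  Both sides of the inequality are expressed through the \<open>e\<^sub>i\<close>. On the one hand \<open>f(X) - f\<^sup>* = \<Sum> e\<^sub>i\<close>.
  On the other hand the logarithm is the matrix with columns \<open>(\<alpha>\<^sub>i / tan \<alpha>\<^sub>i) (y\<^sub>i / cos \<alpha>\<^sub>i - x\<^sub>i)\<close>, up to
  the factor \<open>Q\<^sup>T\<close> (\<open>Gr_Log_principal_vectors\<close>), so its pairing with the negative gradient is
  \<open>2 \<Sum> (\<alpha>\<^sub>i / tan \<alpha>\<^sub>i) e\<^sub>i\<close>. As \<open>t / tan t\<close> decreases, every weight is at least \<open>a\<close>, and the pairing divided by \<open>a\<close>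
  is at least \<open>2 (f(X) - f\<^sup>*)\<close>. One of these two copies gives the left-hand side of the claim. The other
  one dominates the quadratic term, because \<open>sin t \<ge> 2 t / \<pi>\<close> gives
  \<open>\<Sum> e\<^sub>i \<ge> \<delta> \<Sum> sin\<^sup>2 \<alpha>\<^sub>i \<ge> (4 / \<pi>\<^sup>2) \<delta> \<Sum> \<alpha>\<^sub>i\<^sup>2\<close>.

  Distance and logarithm are defined by descriptions, so they have to be shown independent of the
  decomposition used. Both cases rest on one observation (\<open>mat_diag_intertwine\<close>): a matrix that
  intertwines two diagonal matrices also intertwines all functions of them.\<close>

section \<open>Trigonometric inequalities\<close>

text \<open>The bound \<open>c\<^sub>Q > 0.4\<close> is equivalent to this one. It is tight: \<open>\<pi>\<^sup>2\<close> exceeds 9.86. Since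
  \<open>sin (\<pi> / 6) = 1 / 2\<close>, it is enough that the Taylor polynomial of degree 3 makes \<open>sin 0.527\<close> larger than
  \<open>1 / 2\<close>, which gives \<open>\<pi> < 3.162\<close>.\<close>

lemma pi_squared_less_10: "pi\<^sup>2 < 10"
proof -
  have "pi / 6 < 0.527"
  proof (rule ccontr)
    assume "\<not> pi / 6 < 0.527"
    then have "sin 0.527 \<le> sin (pi / 6)" by (intro sin_monotone_2pi_le) auto
    then have le: "sin 0.527 \<le> (1 / 2 :: real)" by (simp add: sin_30)
    (* Five Taylor terms: the coefficient of degree 4 vanishes, and the error bound 0.527^5 / 120 is
       smaller than the margin of the cubic polynomial over 1/2. *)
    have "\<bar>sin 0.527 - (\<Sum>m<5. sin_coeff m * 0.527 ^ m)\<bar> \<le> inverse (fact 5) * \<bar>0.527 :: real\<bar> ^ 5"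
      by (rule Maclaurin_sin_bound)
    moreover have "{..<5} = {0, 1, 2, 3, 4 :: nat}" by auto
    ultimately show False using le
      by (simp add: sin_coeff_def fact_numeral power_divide abs_le_iff)
  qed
  then have "pi\<^sup>2 < 3.162\<^sup>2" by (intro power_strict_mono) auto
  then show ?thesis by (simp add: power2_eq_square)
qed

lemma mult_cos_le_sin:
  fixes x :: real
  assumes "0 \<le> x" "x \<le> pi"
  shows "x * cos x \<le> sin x"
proof -
  have "sin 0 - 0 * cos 0 \<le> sin x - x * cos x"
  proof (rule DERIV_nonneg_imp_nondecreasing[OF assms(1)])
    fix y assume y: "0 \<le> y" "y \<le> x"
    have "((\<lambda>x. sin x - x * cos x) has_real_derivative y * sin y) (at y)"
      by (auto intro!: derivative_eq_intros)
    moreover have "0 \<le> y * sin y" using y assms by (intro mult_nonneg_nonneg sin_ge_zero) auto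
    ultimately show "\<exists>z. ((\<lambda>x. sin x - x * cos x) has_real_derivative z) (at y) \<and> 0 \<le> z" by blast
  qed
  then show ?thesis by simp
qed

text \<open>The quotient \<open>sin t / t\<close> decreases, since the numerator \<open>t cos t - sin t\<close> of its derivative is
  nonpositive, and it equals \<open>2 / \<pi>\<close> at the right end of the interval.\<close>

lemma sin_ge_linear:
  assumes "0 \<le> t" "t \<le> pi / 2"
  shows "2 / pi * t \<le> sin t"
proof (cases "t = 0")
  case False
  have "sin (pi / 2) / (pi / 2) \<le> sin t / t"
  proof (rule DERIV_nonpos_imp_nonincreasing[OF assms(2)])
    fix x assume x: "t \<le> x" "x \<le> pi / 2"
    have "x * cos x \<le> sin x" using x assms by (intro mult_cos_le_sin) auto
    then have "(cos x * x - sin x) / (x * x) \<le> 0" by (intro divide_nonpos_nonneg) (auto simp: mult.commute)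
    moreover have "((\<lambda>x. sin x / x) has_real_derivative (cos x * x - sin x) / (x * x)) (at x)"
      using False assms x by (auto intro!: derivative_eq_intros)
    ultimately show "\<exists>y. ((\<lambda>x. sin x / x) has_real_derivative y) (at x) \<and> y \<le> 0" by blast
  qed
  then show ?thesis using False assms by (simp add: field_simps)
qed simp

text \<open>The derivative of \<open>x cos x / sin x\<close> is \<open>(sin x cos x - x) / sin\<^sup>2 x\<close>, and \<open>sin x cos x \<le> sin x \<le> x\<close>.\<close>

lemma divide_tan_antimono: 
  assumes "0 < s" "s \<le> t" "t < pi / 2"
  shows "t / tan t \<le> s / tan s"
proof -
  have "t * cos t / sin t \<le> s * cos s / sin s"
  proof (rule DERIV_nonpos_imp_nonincreasing[OF assms(2)])
    fix x assume x: "s \<le> x" "x \<le> t"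
    have sx: "sin x > 0" using x assms by (intro sin_gt_zero) auto
    have "((\<lambda>x. x * cos x / sin x) has_real_derivative
       ((cos x - x * sin x) * sin x - x * cos x * cos x) / (sin x * sin x)) (at x)"
      using sx by (auto intro!: derivative_eq_intros)
    moreover have "(cos x - x * sin x) * sin x - x * cos x * cos x = sin x * cos x - x * ((sin x)\<^sup>2 + (cos x)\<^sup>2)"
      unfolding power2_eq_square by (simp only: algebra_simps)
    moreover have "sin x * cos x \<le> x"
    proof -
      have "sin x * cos x \<le> sin x * 1" using sx by (intro mult_left_mono) auto
      also have "\<dots> \<le> x" using sin_x_le_x[of x] x assms by auto
      finally show ?thesis .
    qed
    ultimately show "\<exists>y. ((\<lambda>x. x * cos x / sin x) has_real_derivative y) (at x) \<and> y \<le> 0"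
      by (intro exI conjI) (assumption, auto intro!: divide_nonpos_nonneg)
  qed
  then show ?thesis by (simp add: tan_def)
qed

lemma over_tan_pos: "0 \<le> t \<Longrightarrow> t < pi / 2 \<Longrightarrow> 0 < over_tan t"
  by (auto simp: over_tan_def intro!: divide_pos_pos tan_gt_zero)

lemma over_tan_antimono:
  assumes "0 \<le> s" "s \<le> t" "t < pi / 2"
  shows "over_tan t \<le> over_tan s"
proof (cases "s = 0")
  case True
  have "over_tan t \<le> 1"
  proof (cases "t = 0")
    case False
    then have "0 < sin t" using assms by (intro sin_gt_zero) auto
    then show ?thesis
      using mult_cos_le_sin[of t] False assms by (simp add: over_tan_def tan_def)
  qed (simp add: over_tan_def)
  then show ?thesis using True by (simp add: over_tan_def)
next
  case False
  then show ?thesis using divide_tan_antimono[of s t] assms by (simp add: over_tan_def)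
qed

section \<open>Matrix products, diagonal matrices and traces\<close>

text \<open>Products are normalized to the right by a rule whose side conditions are equations between
  dimensions. The rule with carrier conditions is removed from the simplifier, as it would undo the
  reassociations to the left that cancel a factor against its inverse.\<close>

declare assoc_mult_mat [simp del]

lemma mult_assoc_dim:
  fixes A B C :: "real mat"
  assumes "dim_col A = dim_row B" and "dim_col B = dim_row C"
  shows "A * B * C = A * (B * C)"
  using assms by (intro assoc_mult_mat) auto

lemma transpose_mult_dim:
  fixes A B :: "real mat"
  assumes "dim_col A = dim_row B"
  shows "(A * B)\<^sup>T = B\<^sup>T * A\<^sup>T"
  using assms by (intro transpose_mult) auto

lemma minus_mult_dim:
  fixes A B C :: "real mat"
  assumes "dim_row A = dim_row B" "dim_col A = dim_row C" "dim_col B = dim_row C"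
  shows "(A - B) * C = A * C - B * C"
  using assms by (intro minus_mult_distrib_mat) auto

lemma mult_minus_dim:
  fixes A B C :: "real mat"
  assumes "dim_col A = dim_row B" "dim_col A = dim_row C" "dim_col B = dim_col C"
  shows "A * (B - C) = A * B - A * C"
  using assms by (intro mult_minus_distrib_mat) auto

lemma transpose_minus_dim:
  fixes A B :: "real mat"
  assumes "dim_row A = dim_row B" "dim_col A = dim_col B"
  shows "(A - B)\<^sup>T = A\<^sup>T - B\<^sup>T"
  using assms by (intro transpose_minus) auto

lemma dim_mat_diag [simp]: "dim_row (mat_diag r f) = r" "dim_col (mat_diag r f) = r"
  by (simp_all add: mat_diag_def)

lemma transpose_mat_diag [simp]: "(mat_diag r f)\<^sup>T = mat_diag r f"
  by (intro eq_matI) (auto simp: mat_diag_def)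

lemma index_mult_mat_diag:
  fixes M :: "real mat"
  assumes "i < dim_row M" "j < r" "dim_col M = r"
  shows "(M * mat_diag r f) $$ (i, j) = M $$ (i, j) * f j"
  using assms by (subst mat_diag_mult_right[of _ "dim_row M"]) auto

lemma index_mat_diag_mult:
  fixes M :: "real mat"
  assumes "i < r" "j < dim_col M" "dim_row M = r"
  shows "(mat_diag r f * M) $$ (i, j) = f i * M $$ (i, j)"
  using assms by (subst mat_diag_mult_left[of _ _ "dim_col M"]) auto

lemma index_mult_mat_sum:
  fixes A B :: "real mat"
  assumes "i < dim_row A" "j < dim_col B" "dim_col A = dim_row B"
  shows "(A * B) $$ (i, j) = (\<Sum>l<dim_row B. A $$ (i, l) * B $$ (l, j))"
  using assms by (simp add: scalar_prod_def lessThan_atLeast0)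

lemma index_gram:
  fixes M N :: "real mat"
  assumes "dim_row M = n" "dim_row N = n" "i < dim_col M" "j < dim_col N"
  shows "(M\<^sup>T * N) $$ (i, j) = (\<Sum>l<n. M $$ (l, i) * N $$ (l, j))"
  using assms by (subst index_mult_mat_sum) auto

lemma index_diag_form:
  fixes M N :: "real mat"
  assumes "dim_row M = n" "dim_row N = n" "i < dim_col M" "j < dim_col N"
  shows "(M\<^sup>T * mat_diag n l * N) $$ (i, j) = (\<Sum>a<n. l a * (M $$ (a, i) * N $$ (a, j)))"
proof -
  have "(M\<^sup>T * mat_diag n l * N) $$ (i, j) = (M\<^sup>T * (mat_diag n l * N)) $$ (i, j)"
    using assms by (simp add: mult_assoc_dim del: index_mult_mat(1))
  also have "\<dots> = (\<Sum>a<n. M $$ (a, i) * (mat_diag n l * N) $$ (a, j))"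
    using assms by (subst index_gram) auto
  also have "\<dots> = (\<Sum>a<n. l a * (M $$ (a, i) * N $$ (a, j)))"
    using assms by (intro sum.cong) (auto simp: index_mat_diag_mult simp del: index_mult_mat(1))
  finally show ?thesis .
qed

lemma orthogonal_mat_right_inverse:
  fixes Q :: "real mat"
  assumes "Q \<in> carrier_mat k k" "Q\<^sup>T * Q = 1\<^sub>m k"
  shows "Q * Q\<^sup>T = 1\<^sub>m k"
  using assms by (intro mat_mult_left_right_inverse[of "Q\<^sup>T"]) auto

lemma mat_inverse_eqI:
  fixes M :: "real mat"
  assumes M: "M \<in> carrier_mat k k" and B: "B \<in> carrier_mat k k" and MB: "M * B = 1\<^sub>m k"
  shows "mat_inverse M = Some B"
proof -
  have BM: "B * M = 1\<^sub>m k" using mat_mult_left_right_inverse[OF M B MB] .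
  have "M \<in> Units (ring_mat TYPE(real) k ())"
    using M B MB BM by (auto simp: Units_def ring_mat_simps)
  then obtain B' where B': "mat_inverse M = Some B'"
    using mat_inverse(1)[OF M, of "()"] by (cases "mat_inverse M") auto
  with mat_inverse(2)[OF M] have *: "B' * M = 1\<^sub>m k" "B' \<in> carrier_mat k k" by auto
  have "B' = B' * (M * B)" using * by (simp add: MB)
  also have "\<dots> = B' * M * B" using M B * by (subst mult_assoc_dim) auto
  also have "\<dots> = B" using * B by simp
  finally show ?thesis using B' by simp
qed

lemma mat_trace_comm:
  assumes "dim_col A = dim_row B" "dim_col B = dim_row A"
  shows "mat_trace (A * B) = mat_trace (B * A)"
proof -
  have "mat_trace (A * B) = (\<Sum>i<dim_row A. \<Sum>l<dim_row B. A $$ (i, l) * B $$ (l, i))"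
    using assms by (auto simp: mat_trace_def index_mult_mat_sum simp del: index_mult_mat(1) intro!: sum.cong)
  also have "\<dots> = (\<Sum>l<dim_row B. \<Sum>i<dim_row A. B $$ (l, i) * A $$ (i, l))"
    by (subst sum.swap) (simp add: mult.commute)
  also have "\<dots> = mat_trace (B * A)"
    using assms by (auto simp: mat_trace_def index_mult_mat_sum simp del: index_mult_mat(1) intro!: sum.cong)
  finally show ?thesis .
qed

lemma mat_trace_conjugate_orthogonal:
  assumes M: "M \<in> carrier_mat k k" and Q: "Q \<in> carrier_mat k k" and "Q * Q\<^sup>T = 1\<^sub>m k"
  shows "mat_trace (Q\<^sup>T * M * Q) = mat_trace M"
  using assms by (subst mat_trace_comm) (auto simp: mult_assoc_dim[symmetric])

lemma mat_trace_diag: "mat_trace (mat_diag k f) = (\<Sum>i<k. f i)"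
  by (simp add: mat_trace_def mat_diag_def)

section \<open>Functions of the singular values\<close>

text \<open>Compare entries: \<open>W\<^sub>i\<^sub>j s\<^sub>j = t\<^sub>i W\<^sub>i\<^sub>j\<close> says that \<open>s\<^sub>j = t\<^sub>i\<close> wherever \<open>W\<^sub>i\<^sub>j\<close> is nonzero, and this property is
  inherited by \<open>f (s\<^sub>j)\<close> and \<open>f (t\<^sub>i)\<close>.\<close>

lemma mat_diag_intertwine:
  fixes W :: "real mat"
  assumes W: "W \<in> carrier_mat r' r" and eq: "W * mat_diag r s = mat_diag r' t * W"
  shows "W * mat_diag r (\<lambda>j. f (s j)) = mat_diag r' (\<lambda>i. f (t i)) * W"
proof (rule eq_matI)
  fix i j
  assume "i < dim_row (mat_diag r' (\<lambda>i. f (t i)) * W)" "j < dim_col (mat_diag r' (\<lambda>i. f (t i)) * W)"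
  then have ij: "i < r'" "j < r" using W by auto
  have "W $$ (i, j) * s j = t i * W $$ (i, j)"
    using arg_cong[OF eq, of "\<lambda>M. M $$ (i, j)"] ij W
    by (simp add: index_mult_mat_diag index_mat_diag_mult del: index_mult_mat(1))
  then have "W $$ (i, j) * f (s j) = f (t i) * W $$ (i, j)" by (cases "W $$ (i, j) = 0") auto
  then show "(W * mat_diag r (\<lambda>j. f (s j))) $$ (i, j) = (mat_diag r' (\<lambda>i. f (t i)) * W) $$ (i, j)"
    using ij W by (simp add: index_mult_mat_diag index_mat_diag_mult del: index_mult_mat(1))
qed (use W in auto)

text \<open>The change of basis
  \<open>W = R\<^sup>T Q\<close> is orthogonal and intertwines the two diagonal matrices, hence also their images under
  \<open>f\<close>, and the trace is invariant under conjugation by \<open>W\<close>.\<close>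

lemma sum_over_eigenvalues_unique:
  fixes Q R :: "real mat"
  assumes Q: "Q \<in> carrier_mat k k" "Q\<^sup>T * Q = 1\<^sub>m k"
    and R: "R \<in> carrier_mat k k" "R\<^sup>T * R = 1\<^sub>m k"
    and eq: "Q * mat_diag k s * Q\<^sup>T = R * mat_diag k t * R\<^sup>T"
  shows "(\<Sum>i<k. f (s i)) = (\<Sum>i<k. f (t i) :: real)"
proof -
  let ?W = "R\<^sup>T * Q"
  have dim [simp]: "dim_row Q = k" "dim_col Q = k" "dim_row R = k" "dim_col R = k"
    using Q R by auto
  note QQ = orthogonal_mat_right_inverse[OF Q] and RR = orthogonal_mat_right_inverse[OF R]
  have "?W * mat_diag k s = R\<^sup>T * (Q * mat_diag k s * Q\<^sup>T) * Q"
    by (simp add: mult_assoc_dim Q)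
  also have "\<dots> = (R\<^sup>T * R) * mat_diag k t * ?W"
    unfolding eq by (simp add: mult_assoc_dim)
  finally have "?W * mat_diag k s = mat_diag k t * ?W" by (simp add: R)
  from mat_diag_intertwine[OF _ this, of f]
  have W: "?W * mat_diag k (\<lambda>i. f (s i)) = mat_diag k (\<lambda>i. f (t i)) * ?W" using Q R by auto
  have "?W\<^sup>T * ?W = Q\<^sup>T * (R * R\<^sup>T) * Q" by (simp add: mult_assoc_dim transpose_mult_dim)
  then have WW: "?W\<^sup>T * ?W = 1\<^sub>m k" by (simp add: RR Q)
  have WW': "?W * ?W\<^sup>T = 1\<^sub>m k" using WW Q R by (intro orthogonal_mat_right_inverse) auto
  have "(\<Sum>i<k. f (s i)) = mat_trace (?W\<^sup>T * ?W * mat_diag k (\<lambda>i. f (s i)))"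
    by (simp add: WW mat_trace_diag)
  also have "\<dots> = mat_trace (?W\<^sup>T * (?W * mat_diag k (\<lambda>i. f (s i))))"
    by (subst mult_assoc_dim) auto
  also have "\<dots> = mat_trace (?W\<^sup>T * (mat_diag k (\<lambda>i. f (t i)) * ?W))"
    by (simp only: W)
  also have "\<dots> = mat_trace (mat_diag k (\<lambda>i. f (t i)) * ?W * ?W\<^sup>T)"
    by (subst mat_trace_comm) auto
  also have "\<dots> = mat_trace (mat_diag k (\<lambda>i. f (t i)) * (?W * ?W\<^sup>T))"
    by (subst mult_assoc_dim) auto
  also have "\<dots> = (\<Sum>i<k. f (t i))" by (simp add: WW' mat_trace_diag)
  finally show ?thesis .
qed

text \<open>The left-hand side applies \<open>h\<close> to the singular values of \<open>M\<close> in an arbitrary decomposition; the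
  right-hand side depends only on one fixed diagonalization of \<open>M\<^sup>T M\<close>, so the former does not depend on
  the decomposition or on the number of retained singular values. Dividing \<open>h\<close> by its argument
  eliminates \<open>U\<close>: since \<open>M V = U (diag s)\<close>, the left-hand side is \<open>M V (diag \<phi>(s)) V\<^sup>T\<close>, and \<open>W = Q\<^sup>T V\<close>
  intertwines \<open>diag s\<^sup>2\<close> with \<open>diag t\<^sup>2\<close>, which allows \<open>\<phi>\<close> to be moved from the basis \<open>V\<close> to the basis
  \<open>Q\<close>. The value of \<open>\<phi>\<close> at 0 is arbitrary.\<close>

lemma svd_functional_calculus:
  assumes svd: "is_svd r M U s V" and M: "M \<in> carrier_mat m k"
    and Q: "Q \<in> carrier_mat k k" "Q\<^sup>T * Q = 1\<^sub>m k"
    and gram: "M\<^sup>T * M = Q * mat_diag k (\<lambda>i. (t i)\<^sup>2) * Q\<^sup>T"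
    and t: "\<And>i. i < k \<Longrightarrow> 0 \<le> t i"
    and h: "\<And>x. 0 \<le> x \<Longrightarrow> h x = x * \<phi> x"
  shows "U * mat_diag r (\<lambda>i. h (s i)) * V\<^sup>T = M * Q * mat_diag k (\<lambda>i. \<phi> (t i)) * Q\<^sup>T"
proof -
  let ?W = "Q\<^sup>T * V"
  let ?Ds = "mat_diag r s" and ?Ps = "mat_diag r (\<lambda>i. \<phi> (s i))" and ?Pt = "mat_diag k (\<lambda>i. \<phi> (t i))"
  have U: "U \<in> carrier_mat m r" "U\<^sup>T * U = 1\<^sub>m r" and V: "V \<in> carrier_mat k r" "V\<^sup>T * V = 1\<^sub>m r"
    and s: "\<And>i. i < r \<Longrightarrow> 0 \<le> s i" and M_eq: "M = U * ?Ds * V\<^sup>T"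
    using svd M by (auto simp: is_svd_def)
  have dim [simp]: "dim_row U = m" "dim_col U = r" "dim_row V = k" "dim_col V = r"
    "dim_row Q = k" "dim_col Q = k" "dim_row M = m" "dim_col M = k"
    using U V Q M by auto
  note QQ = orthogonal_mat_right_inverse[OF Q]
  have VV [simp]: "V\<^sup>T * (V * B) = B" if "dim_row B = r" for B
    using that by (simp add: V flip: mult_assoc_dim)
  have QQ1 [simp]: "Q\<^sup>T * (Q * B) = B" if "dim_row B = k" for B
    using that by (simp add: Q flip: mult_assoc_dim)
  have QQ2 [simp]: "Q * (Q\<^sup>T * B) = B" if "dim_row B = k" for B
    using that by (simp add: QQ flip: mult_assoc_dim)
  have gram': "M\<^sup>T * M = V * (?Ds * (U\<^sup>T * U) * ?Ds) * V\<^sup>T"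
    unfolding M_eq by (simp add: mult_assoc_dim transpose_mult_dim)
  then have gram': "M\<^sup>T * M = V * mat_diag r (\<lambda>i. (s i)\<^sup>2) * V\<^sup>T"
    by (simp add: U power2_eq_square)
  have "?W * mat_diag r (\<lambda>i. (s i)\<^sup>2) = Q\<^sup>T * (M\<^sup>T * M) * V"
    unfolding gram' by (simp add: mult_assoc_dim V)
  also have "\<dots> = mat_diag k (\<lambda>i. (t i)\<^sup>2) * ?W"
    unfolding gram by (simp add: mult_assoc_dim)
  finally have W: "?W * mat_diag r (\<lambda>i. (s i)\<^sup>2) = mat_diag k (\<lambda>i. (t i)\<^sup>2) * ?W" .
  (* Functions of s^2 are functions of s through the square root, as s and t are nonnegative. *)
  have cong: "mat_diag r (\<lambda>i. \<phi> (sqrt ((s i)\<^sup>2))) = ?Ps" "mat_diag k (\<lambda>i. \<phi> (sqrt ((t i)\<^sup>2))) = ?Pt"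
    using s t by (auto simp: mat_diag_def intro!: eq_matI)
  have W\<phi>: "?W * ?Ps = ?Pt * ?W"
    unfolding cong[symmetric]
    by (rule mat_diag_intertwine[OF _ W, of "\<lambda>x. \<phi> (sqrt x)"]) (use V Q in auto)
  have W\<phi>': "?Ps * ?W\<^sup>T = ?W\<^sup>T * ?Pt"
    using arg_cong[OF W\<phi>, of transpose_mat] by (simp add: transpose_mult_dim mult_assoc_dim)
  have MVV: "M * (V * V\<^sup>T) = M"
    unfolding M_eq by (simp add: mult_assoc_dim)
  have "mat_diag r (\<lambda>i. h (s i)) = ?Ds * ?Ps"
    unfolding mat_diag_diag using s by (auto simp: mat_diag_def h intro!: eq_matI)
  then have "U * mat_diag r (\<lambda>i. h (s i)) * V\<^sup>T = U * ?Ds * V\<^sup>T * V * ?Ps * V\<^sup>T"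
    by (simp add: mult_assoc_dim del: mat_diag_diag)
  also have "\<dots> = M * V * (?Ps * ?W\<^sup>T) * Q\<^sup>T"
    by (simp add: M_eq[symmetric] mult_assoc_dim transpose_mult_dim QQ)
  also have "\<dots> = M * (V * V\<^sup>T) * (Q * ?Pt * Q\<^sup>T)"
    unfolding W\<phi>' by (simp add: mult_assoc_dim transpose_mult_dim)
  also have "\<dots> = M * Q * ?Pt * Q\<^sup>T"
    unfolding MVV by (simp add: mult_assoc_dim)
  finally show ?thesis .
qed

text \<open>The columns of \<open>M Q\<close> are orthogonal with lengths \<open>t\<^sub>i\<close>. The nonzero ones, normalized, are the left
  singular vectors; the zero ones contribute nothing to \<open>M = (M Q) Q\<^sup>T\<close> and are left out.\<close>

lemma svd_exists_of_gram:
  assumes M: "M \<in> carrier_mat m k" and Q: "Q \<in> carrier_mat k k" "Q\<^sup>T * Q = 1\<^sub>m k"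
    and gram: "M\<^sup>T * M = Q * mat_diag k (\<lambda>i. (t i)\<^sup>2) * Q\<^sup>T"
    and t: "\<And>i. i < k \<Longrightarrow> 0 \<le> t i"
  shows "\<exists>r U s V. is_svd r M U s V"
proof -
  define N where "N = M * Q"
  define S where "S = {i. i < k \<and> t i \<noteq> 0}"
  define r where "r = card S"
  have "finite S" by (simp add: S_def)
  then obtain e where e: "bij_betw e {..<r} S"
    using ex_bij_betw_nat_finite[of S] by (auto simp: r_def lessThan_atLeast0)
  have eS: "e j < k \<and> t (e j) \<noteq> 0" if "j < r" for j
    using bij_betwE[OF e] that by (auto simp: S_def)
  have e_inj: "e i = e j \<longleftrightarrow> i = j" if "i < r" "j < r" for i j
    using bij_betw_imp_inj_on[OF e] that by (auto simp: inj_on_def)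
  define U where "U = mat m r (\<lambda>(a, j). N $$ (a, e j) / t (e j))"
  define V where "V = mat k r (\<lambda>(a, j). Q $$ (a, e j))"
  have dim [simp]: "dim_row Q = k" "dim_col Q = k" "dim_row M = m" "dim_col M = k"
    "dim_row N = m" "dim_col N = k" "dim_row U = m" "dim_col U = r" "dim_row V = k" "dim_col V = r"
    using Q M by (auto simp: N_def U_def V_def)
  note QQ = orthogonal_mat_right_inverse[OF Q]
  have "N\<^sup>T * N = Q\<^sup>T * (M\<^sup>T * M) * Q"
    by (simp add: N_def mult_assoc_dim transpose_mult_dim)
  also have "\<dots> = (Q\<^sup>T * Q) * mat_diag k (\<lambda>i. (t i)\<^sup>2) * (Q\<^sup>T * Q)"
    unfolding gram by (simp add: mult_assoc_dim)
  finally have NN: "N\<^sup>T * N = mat_diag k (\<lambda>i. (t i)\<^sup>2)" by (simp add: Q)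
  have N_orth: "(\<Sum>a<m. N $$ (a, i) * N $$ (a, j)) = (if i = j then (t i)\<^sup>2 else 0)"
    if "i < k" "j < k" for i j
  proof -
    have "(\<Sum>a<m. N $$ (a, i) * N $$ (a, j)) = (N\<^sup>T * N) $$ (i, j)"
      using that by (subst index_mult_mat_sum) auto
    also have "\<dots> = (if i = j then (t i)\<^sup>2 else 0)"
      unfolding NN using that by (simp add: mat_diag_def)
    finally show ?thesis .
  qed
  have N_zero: "N $$ (a, i) = 0" if "a < m" "i < k" "t i = 0" for a i
  proof -
    have "(\<Sum>a<m. N $$ (a, i) * N $$ (a, i)) = 0" using N_orth[of i i] that by simp
    then have "N $$ (a, i) * N $$ (a, i) = 0"
      by (rule sum_nonneg_0[of "{..<m}", rotated 2]) (use that in auto)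
    then show ?thesis by simp
  qed
  have Q_orth: "(\<Sum>a<k. Q $$ (a, i) * Q $$ (a, j)) = (if i = j then 1 else 0)"
    if "i < k" "j < k" for i j
  proof -
    have "(\<Sum>a<k. Q $$ (a, i) * Q $$ (a, j)) = (Q\<^sup>T * Q) $$ (i, j)"
      using that by (subst index_mult_mat_sum) auto
    also have "\<dots> = (if i = j then 1 else 0)"
      unfolding Q(2) using that by simp
    finally show ?thesis .
  qed
  have UU: "U\<^sup>T * U = 1\<^sub>m r"
  proof (rule eq_matI)
    fix i j assume "i < dim_row (1\<^sub>m r :: real mat)" "j < dim_col (1\<^sub>m r :: real mat)"
    then have ij: "i < r" "j < r" by auto
    then have "(U\<^sup>T * U) $$ (i, j) = (\<Sum>a<m. N $$ (a, e i) * N $$ (a, e j)) / (t (e i) * t (e j))"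
      by (subst index_mult_mat_sum) (auto simp: U_def sum_divide_distrib)
    then show "(U\<^sup>T * U) $$ (i, j) = 1\<^sub>m r $$ (i, j)"
      using ij eS[of i] eS[of j] by (simp add: N_orth e_inj power2_eq_square)
  qed auto
  have VV: "V\<^sup>T * V = 1\<^sub>m r"
  proof (rule eq_matI)
    fix i j assume "i < dim_row (1\<^sub>m r :: real mat)" "j < dim_col (1\<^sub>m r :: real mat)"
    then have ij: "i < r" "j < r" by auto
    then have "(V\<^sup>T * V) $$ (i, j) = (\<Sum>a<k. Q $$ (a, e i) * Q $$ (a, e j))"
      by (subst index_mult_mat_sum) (auto simp: V_def)
    then show "(V\<^sup>T * V) $$ (i, j) = 1\<^sub>m r $$ (i, j)"
      using ij eS[of i] eS[of j] by (simp add: Q_orth e_inj)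
  qed auto
  have "M = N * Q\<^sup>T" by (simp add: N_def mult_assoc_dim QQ)
  also have "\<dots> = U * mat_diag r (\<lambda>j. t (e j)) * V\<^sup>T"
  proof (rule eq_matI)
    fix a b
    assume "a < dim_row (U * mat_diag r (\<lambda>j. t (e j)) * V\<^sup>T)"
      and "b < dim_col (U * mat_diag r (\<lambda>j. t (e j)) * V\<^sup>T)"
    then have ab: "a < m" "b < k" by auto
    have "(N * Q\<^sup>T) $$ (a, b) = (\<Sum>l<k. N $$ (a, l) * Q $$ (b, l))"
      using ab by (subst index_mult_mat_sum) auto
    also have "\<dots> = (\<Sum>l\<in>S. N $$ (a, l) * Q $$ (b, l))"
      using ab by (intro sum.mono_neutral_right) (auto simp: S_def N_zero)
    also have "\<dots> = (\<Sum>j<r. N $$ (a, e j) * Q $$ (b, e j))"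
      by (rule sum.reindex_bij_betw[OF e, symmetric])
    also have "\<dots> = (\<Sum>j<r. (U * mat_diag r (\<lambda>j. t (e j))) $$ (a, j) * V\<^sup>T $$ (j, b))"
      using ab eS by (intro sum.cong)
        (auto simp: index_mult_mat_diag U_def V_def simp del: index_mult_mat(1))
    also have "\<dots> = (U * mat_diag r (\<lambda>j. t (e j)) * V\<^sup>T) $$ (a, b)"
      using ab by (subst (2) index_mult_mat_sum) auto
    finally show "(N * Q\<^sup>T) $$ (a, b) = (U * mat_diag r (\<lambda>j. t (e j)) * V\<^sup>T) $$ (a, b)" .
  qed auto
  finally have "is_svd r M U (\<lambda>j. t (e j)) V"
    using UU VV eS t by (auto simp: is_svd_def U_def V_def)
  then show ?thesis by blast
qed

section \<open>Distance and logarithm in terms of principal vectors\<close>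

text \<open>The numbers \<open>cos\<^sup>2 \<theta>\<^sub>i\<close> are the eigenvalues of \<open>(Y\<^sup>T X)\<^sup>T (Y\<^sup>T X)\<close>, and \<open>\<theta>\<^sub>i\<^sup>2\<close> is a function of
  \<open>cos\<^sup>2 \<theta>\<^sub>i\<close> because the angles lie between 0 and \<open>\<pi> / 2\<close>.\<close>

lemma sum_principal_angles_squared_unique:
  assumes X: "X \<in> carrier_mat n k" and Y: "Y \<in> carrier_mat n k"
    and \<theta>: "principal_angles X Y \<theta>" and \<phi>: "principal_angles X Y \<phi>"
  shows "(\<Sum>i=1..k. (\<theta> i)\<^sup>2) = (\<Sum>i=1..k. (\<phi> i)\<^sup>2)"
proof -
  have gram: "\<exists>Q. Q \<in> carrier_mat k k \<and> Q\<^sup>T * Q = 1\<^sub>m k \<and>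
      (Y\<^sup>T * X)\<^sup>T * (Y\<^sup>T * X) = Q * mat_diag k (\<lambda>i. (cos (\<psi> (Suc i)))\<^sup>2) * Q\<^sup>T"
    if \<psi>: "principal_angles X Y \<psi>" for \<psi>
  proof -
    obtain P Q where "is_svd k (Y\<^sup>T * X) P (\<lambda>i. cos (\<psi> (Suc i))) Q"
      using \<psi> X by (auto simp: principal_angles_def)
    then have P: "P \<in> carrier_mat k k" "P\<^sup>T * P = 1\<^sub>m k" and Q: "Q \<in> carrier_mat k k" "Q\<^sup>T * Q = 1\<^sub>m k"
      and M: "Y\<^sup>T * X = P * mat_diag k (\<lambda>i. cos (\<psi> (Suc i))) * Q\<^sup>T"
      using X Y by (auto simp: is_svd_def)
    have [simp]: "dim_row P = k" "dim_col P = k" "dim_row Q = k" "dim_col Q = k"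
      using P Q by auto
    let ?D = "mat_diag k (\<lambda>i. cos (\<psi> (Suc i)))"
    have "(Y\<^sup>T * X)\<^sup>T * (Y\<^sup>T * X) = Q * (?D * (P\<^sup>T * P) * ?D) * Q\<^sup>T"
      unfolding M by (simp add: transpose_mult_dim mult_assoc_dim)
    then show ?thesis using Q by (auto simp: P power2_eq_square)
  qed
  have angle: "(arccos (sqrt ((cos (\<psi> (Suc i)))\<^sup>2)))\<^sup>2 = (\<psi> (Suc i))\<^sup>2"
    if \<psi>: "principal_angles X Y \<psi>" and "i < k" for \<psi> i
  proof -
    have "0 \<le> \<psi> (Suc i)" "\<psi> (Suc i) \<le> pi / 2"
      using \<psi> X \<open>i < k\<close> by (auto simp: principal_angles_def)
    then show ?thesis by (simp add: cos_ge_zero arccos_cos)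
  qed
  have shift: "(\<Sum>i=1..k. (\<psi> i)\<^sup>2) = (\<Sum>i<k. (arccos (sqrt ((cos (\<psi> (Suc i)))\<^sup>2)))\<^sup>2)"
    if "principal_angles X Y \<psi>" for \<psi>
    using angle[OF that]
    by (simp add: sum.atLeast1_atMost_eq)
  obtain Q R where "Q \<in> carrier_mat k k" "Q\<^sup>T * Q = 1\<^sub>m k" "R \<in> carrier_mat k k" "R\<^sup>T * R = 1\<^sub>m k"
    "Q * mat_diag k (\<lambda>i. (cos (\<theta> (Suc i)))\<^sup>2) * Q\<^sup>T = R * mat_diag k (\<lambda>i. (cos (\<phi> (Suc i)))\<^sup>2) * R\<^sup>T"
    using gram[OF \<theta>] gram[OF \<phi>] by metis
  from sum_over_eigenvalues_unique[OF this, of "\<lambda>x. (arccos (sqrt x))\<^sup>2"]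
  show ?thesis by (simp only: shift[OF \<theta>] shift[OF \<phi>])
qed

lemma Gr_dist_squared:
  assumes "X \<in> carrier_mat n k" "Y \<in> carrier_mat n k" "principal_angles X Y \<theta>"
  shows "(Gr_dist X Y)\<^sup>2 = (\<Sum>i=1..k. (\<theta> i)\<^sup>2)"
proof -
  have k: "dim_col X = k" using assms by simp
  have "Gr_dist X Y = sqrt (\<Sum>i=1..k. (\<theta> i)\<^sup>2)"
    unfolding Gr_dist_def k
  proof (rule the_equality)
    fix d assume "\<exists>\<phi>. principal_angles X Y \<phi> \<and> d = sqrt (\<Sum>i=1..k. (\<phi> i)\<^sup>2)"
    then show "d = sqrt (\<Sum>i=1..k. (\<theta> i)\<^sup>2)"
      using sum_principal_angles_squared_unique[OF assms(1,2) _ assms(3)] by metis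
  qed (use assms in blast)
  then show ?thesis by (simp add: sum_nonneg)
qed

text \<open>Here \<open>arctan\<close> is applied to the singular values \<open>tan \<alpha>\<^sub>i\<close> of \<open>M\<close>; the quotient \<open>arctan x / x\<close> at
  \<open>x = tan \<alpha>\<^sub>i\<close> is \<open>\<alpha>\<^sub>i / tan \<alpha>\<^sub>i\<close>.\<close>

lemma Gr_Log_of_gram:
  fixes X Y :: "real mat"
  defines "M \<equiv> (1\<^sub>m (dim_row X) - X * X\<^sup>T) * Y * the (mat_inverse (X\<^sup>T * Y))"
  assumes M: "M \<in> carrier_mat m k" and Q: "Q \<in> carrier_mat k k" "Q\<^sup>T * Q = 1\<^sub>m k"
    and gram: "M\<^sup>T * M = Q * mat_diag k (\<lambda>i. (tan (\<alpha> i))\<^sup>2) * Q\<^sup>T"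
    and \<alpha>: "\<And>i. i < k \<Longrightarrow> 0 \<le> \<alpha> i \<and> \<alpha> i < pi / 2"
  shows "Gr_Log X Y = M * Q * mat_diag k (\<lambda>i. over_tan (\<alpha> i)) * Q\<^sup>T"
proof -
  define \<phi> :: "real \<Rightarrow> real" where "\<phi> x = (if x = 0 then 1 else arctan x / x)" for x
  have arctan_\<phi>: "arctan x = x * \<phi> x" for x by (simp add: \<phi>_def)
  have tan: "0 \<le> tan (\<alpha> i)" if "i < k" for i
    using \<alpha>[OF that] by (cases "\<alpha> i = 0") (auto intro!: less_imp_le tan_gt_zero)
  have "over_tan (\<alpha> i) = \<phi> (tan (\<alpha> i))" if "i < k" for i
  proof (cases "\<alpha> i = 0")
    case False
    then have "0 < tan (\<alpha> i)" using \<alpha>[OF that] by (intro tan_gt_zero) auto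
    moreover have "arctan (tan (\<alpha> i)) = \<alpha> i" using \<alpha>[OF that] by (intro arctan_tan) auto
    ultimately show ?thesis using False by (simp add: \<phi>_def over_tan_def)
  qed (simp add: \<phi>_def over_tan_def)
  then have \<phi>: "mat_diag k (\<lambda>i. \<phi> (tan (\<alpha> i))) = mat_diag k (\<lambda>i. over_tan (\<alpha> i))"
    by (auto simp: mat_diag_def intro!: eq_matI)
  have any_svd: "U * mat_diag r (\<lambda>i. arctan (s i)) * V\<^sup>T
      = M * Q * mat_diag k (\<lambda>i. over_tan (\<alpha> i)) * Q\<^sup>T"
    if "is_svd r M U s V" for r U s V
    unfolding \<phi>[symmetric] by (rule svd_functional_calculus[OF that M Q gram tan]) (simp_all add: arctan_\<phi>)
  obtain r U s V where "is_svd r M U s V"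
    using svd_exists_of_gram[OF M Q gram tan] by blast
  with any_svd show ?thesis
    unfolding Gr_Log_def M_def[symmetric] by (intro the_equality) metis+
qed

text \<open>With \<open>c = diag (cos \<alpha>)\<close>, the inverse of \<open>X\<^sup>T Y\<close> is \<open>B = P c\<^sup>-\<^sup>1 Q\<^sup>T\<close>, so that
  \<open>(1 - X X\<^sup>T) Y B = Y B - X = R Q\<^sup>T\<close>. The columns of \<open>R\<close> are orthogonal to \<open>X\<close>, and
  \<open>R\<^sup>T R = c\<^sup>-\<^sup>2 - 1 = diag (tan\<^sup>2 \<alpha>)\<close>.\<close>

lemma Gr_Log_principal_vectors:
  assumes X: "X \<in> Gr_rep n k" and Y: "Y \<in> Gr_rep n k"
    and svd: "is_svd k (Y\<^sup>T * X) P (\<lambda>i. cos (\<alpha> i)) Q"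
    and \<alpha>: "\<And>i. i < k \<Longrightarrow> 0 \<le> \<alpha> i \<and> \<alpha> i < pi / 2"
  defines "R \<equiv> Y * P * mat_diag k (\<lambda>i. 1 / cos (\<alpha> i)) - X * Q"
  shows "X\<^sup>T * R = 0\<^sub>m k k"
    and "Gr_Log X Y = R * mat_diag k (\<lambda>i. over_tan (\<alpha> i)) * Q\<^sup>T"
proof -
  let ?c = "mat_diag k (\<lambda>i. cos (\<alpha> i))" and ?c' = "mat_diag k (\<lambda>i. 1 / cos (\<alpha> i))"
  have XX: "X \<in> carrier_mat n k" "X\<^sup>T * X = 1\<^sub>m k" and YY: "Y \<in> carrier_mat n k" "Y\<^sup>T * Y = 1\<^sub>m k"
    using X Y by (auto simp: Gr_rep_def)
  then have P: "P \<in> carrier_mat k k" "P\<^sup>T * P = 1\<^sub>m k" and Q: "Q \<in> carrier_mat k k" "Q\<^sup>T * Q = 1\<^sub>m k"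
    and YX: "Y\<^sup>T * X = P * ?c * Q\<^sup>T"
    using svd by (auto simp: is_svd_def)
  have dim [simp]: "dim_row X = n" "dim_col X = k" "dim_row Y = n" "dim_col Y = k"
    "dim_row P = k" "dim_col P = k" "dim_row Q = k" "dim_col Q = k" "dim_row R = n" "dim_col R = k"
    using XX YY P Q by (auto simp: R_def)
  note QQ = orthogonal_mat_right_inverse[OF Q]
  have cos_pos: "cos (\<alpha> i) > 0" if "i < k" for i using \<alpha>[OF that] by (intro cos_gt_zero_pi) auto
  then have cos_nz: "cos (\<alpha> i) \<noteq> 0" if "i < k" for i using that by force
  have cc: "?c * ?c' = 1\<^sub>m k" "?c' * ?c = 1\<^sub>m k"
    unfolding mat_diag_diag by (auto simp: mat_diag_def cos_nz intro!: eq_matI)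
  have cancel [simp]: "P\<^sup>T * (P * B) = B" "Q\<^sup>T * (Q * B) = B" "Q * (Q\<^sup>T * B) = B" "?c * (?c' * B) = B"
    "?c' * (?c * B) = B" "X\<^sup>T * (X * B) = B" "Y\<^sup>T * (Y * B) = B"
    "Y\<^sup>T * (X * B) = P * (?c * (Q\<^sup>T * B))" if "dim_row B = k" for B
    using that by (simp_all add: P Q QQ cc XX YY YX mult_assoc_dim[symmetric] del: mat_diag_diag)
  have XY: "X\<^sup>T * Y = Q * ?c * P\<^sup>T"
    using arg_cong[OF YX, of transpose_mat] by (simp add: transpose_mult_dim mult_assoc_dim)
  have cancelXY [simp]: "X\<^sup>T * (Y * B) = Q * (?c * (P\<^sup>T * B))" if "dim_row B = k" for B
    using that
    by (subst mult_assoc_dim[of "X\<^sup>T" Y B, symmetric]) (simp_all add: XY mult_assoc_dim)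
  define B where "B = P * ?c' * Q\<^sup>T"
  have [simp]: "dim_row B = k" "dim_col B = k" by (auto simp: B_def)
  have XYB1: "X\<^sup>T * Y * B = 1\<^sub>m k"
    unfolding XY B_def by (simp add: mult_assoc_dim QQ del: mat_diag_diag)
  have "mat_inverse (X\<^sup>T * Y) = Some B"
  proof (rule mat_inverse_eqI[OF _ _ XYB1])
    show "X\<^sup>T * Y \<in> carrier_mat k k" "B \<in> carrier_mat k k"
      by (rule carrier_matI, simp, simp)+
  qed
  then have inv: "the (mat_inverse (X\<^sup>T * Y)) = B" by simp
  have XYB: "X\<^sup>T * (Y * B) = 1\<^sub>m k"
    by (simp add: B_def mult_assoc_dim QQ del: mat_diag_diag)
  have M: "(1\<^sub>m (dim_row X) - X * X\<^sup>T) * Y * the (mat_inverse (X\<^sup>T * Y)) = R * Q\<^sup>T"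
    unfolding inv
    by (simp add: minus_mult_dim mult_assoc_dim XYB del: cancelXY)
      (simp add: R_def minus_mult_dim B_def mult_assoc_dim QQ)
  show XR: "X\<^sup>T * R = 0\<^sub>m k k"
    unfolding R_def by (simp add: mult_minus_dim mult_assoc_dim P cc minus_r_inv_mat[OF Q(1)] del: mat_diag_diag)
  have RR: "R\<^sup>T * R = ?c' * ?c' - 1\<^sub>m k - (1\<^sub>m k - 1\<^sub>m k)"
    unfolding R_def
    by (simp add: mult_minus_dim minus_mult_dim transpose_minus_dim transpose_mult_dim mult_assoc_dim P Q cc
      del: mat_diag_diag)
  have tan2: "1 / cos (\<alpha> i) * (1 / cos (\<alpha> i)) - 1 = (tan (\<alpha> i))\<^sup>2" if "i < k" for i
    using tan_sec[OF cos_nz[OF that]] by (simp add: power2_eq_square field_simps)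
  have "?c' * ?c' - 1\<^sub>m k - (1\<^sub>m k - 1\<^sub>m k) = mat_diag k (\<lambda>i. (tan (\<alpha> i))\<^sup>2)"
    unfolding mat_diag_diag
    by (auto simp: mat_diag_def tan2 intro!: eq_matI
      simp del: times_divide_eq_left times_divide_eq_right)
  with RR have RR: "R\<^sup>T * R = mat_diag k (\<lambda>i. (tan (\<alpha> i))\<^sup>2)"
    by (rule trans)
  have RQ_gram: "(R * Q\<^sup>T)\<^sup>T * (R * Q\<^sup>T) = Q * mat_diag k (\<lambda>i. (tan (\<alpha> i))\<^sup>2) * Q\<^sup>T"
    unfolding RR[symmetric] by (simp add: transpose_mult_dim mult_assoc_dim)
  have RQ: "R * Q\<^sup>T \<in> carrier_mat n k" by (rule carrier_matI) simp_all
  have "Gr_Log X Y = R * Q\<^sup>T * Q * mat_diag k (\<lambda>i. over_tan (\<alpha> i)) * Q\<^sup>T"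
    using Gr_Log_of_gram[of X Y n k Q \<alpha>, unfolded M, OF RQ Q RQ_gram \<alpha>] .
  then show "Gr_Log X Y = R * mat_diag k (\<lambda>i. over_tan (\<alpha> i)) * Q\<^sup>T"
    by (simp add: mult_assoc_dim)
qed

section \<open>Subspaces and eigenvectors\<close>

lemma col_spanD:
  assumes "Y \<in> carrier_mat n k" and "w \<in> col_span Y"
  shows "\<exists>z \<in> carrier_vec k. w = Y *\<^sub>v z"
  using assms vec_space.col_space_eq[OF assms(1)] by (auto simp: col_span_def)

lemma vec_span_superset:
  assumes "S \<subseteq> carrier_vec n"
  shows "S \<subseteq> vec_span n S"
proof -
  interpret vec_space "TYPE(real)" n .
  show ?thesis using in_own_span[of S] assms by (simp add: vec_span_def)
qed

text \<open>Writing \<open>W = Y Z\<close>, orthonormality of the columns of \<open>Y\<close> and \<open>W\<close> makes the square matrix \<open>Z\<close>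
  orthogonal. One inclusion of spans is therefore enough.\<close>

lemma projector_eq_of_columns_in_span:
  assumes Y: "Y \<in> Gr_rep n k" and W: "W \<in> Gr_rep n k"
    and cols: "\<And>j. j < k \<Longrightarrow> col W j \<in> col_span Y"
  shows "Y * Y\<^sup>T = W * W\<^sup>T"
proof -
  have YY: "Y \<in> carrier_mat n k" "Y\<^sup>T * Y = 1\<^sub>m k" and WW: "W \<in> carrier_mat n k" "W\<^sup>T * W = 1\<^sub>m k"
    using Y W by (auto simp: Gr_rep_def)
  have "\<forall>j. \<exists>z. j < k \<longrightarrow> z \<in> carrier_vec k \<and> col W j = Y *\<^sub>v z"
    using col_spanD[OF YY(1) cols] by blast
  then obtain z where z: "\<And>j. j < k \<Longrightarrow> z j \<in> carrier_vec k \<and> col W j = Y *\<^sub>v z j" by metis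
  define Z where "Z = mat k k (\<lambda>(i, j). z j $ i)"
  have [simp]: "dim_row Y = n" "dim_col Y = k" "dim_row Z = k" "dim_col Z = k" using YY by (auto simp: Z_def)
  have W_eq: "W = Y * Z"
  proof (rule mat_col_eqI)
    fix j assume "j < dim_col (Y * Z)"
    then have j: "j < k" by simp
    have "col Z j = z j" using z[OF j] j by (auto simp: Z_def)
    then show "col W j = col (Y * Z) j" using z[OF j] j YY by (subst col_mult2[of _ n k _ k]) (auto simp: Z_def)
  qed (use WW in auto)
  have "Z\<^sup>T * (Y\<^sup>T * Y) * Z = W\<^sup>T * W" by (simp add: W_eq mult_assoc_dim transpose_mult_dim)
  then have "Z\<^sup>T * Z = 1\<^sub>m k" by (simp add: YY WW)
  then have "Z * Z\<^sup>T = 1\<^sub>m k" by (intro orthogonal_mat_right_inverse) (auto simp: Z_def)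
  then have "Y * (Z * Z\<^sup>T) * Y\<^sup>T = Y * Y\<^sup>T" by simp
  then show ?thesis by (simp add: W_eq mult_assoc_dim transpose_mult_dim)
qed

lemma spectral_decomposition:
  fixes A :: "real mat" and v :: "nat \<Rightarrow> real vec"
  assumes A: "A \<in> carrier_mat n n"
    and v: "\<And>j. j < n \<Longrightarrow> v j \<in> carrier_vec n"
    and orth: "\<And>i j. i < n \<Longrightarrow> j < n \<Longrightarrow> v i \<bullet> v j = (if i = j then 1 else 0)"
    and eigen: "\<And>j. j < n \<Longrightarrow> A *\<^sub>v v j = lam j \<cdot>\<^sub>v v j"
  defines "V \<equiv> mat n n (\<lambda>(a, j). v j $ a)"
  shows "V\<^sup>T * V = 1\<^sub>m n" and "V * V\<^sup>T = 1\<^sub>m n" and "A = V * mat_diag n lam * V\<^sup>T"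
proof -
  have V: "V \<in> carrier_mat n n" by (simp add: V_def)
  then have [simp]: "dim_row V = n" "dim_col V = n" "dim_row A = n" "dim_col A = n" using A by auto
  have col: "col V j = v j" if "j < n" for j using v[OF that] that by (auto simp: V_def)
  show VV: "V\<^sup>T * V = 1\<^sub>m n" by (rule eq_matI) (auto simp: col orth)
  show VV': "V * V\<^sup>T = 1\<^sub>m n" by (rule orthogonal_mat_right_inverse[OF V VV])
  have "A * V = V * mat_diag n lam"
  proof (rule eq_matI)
    fix a j assume "a < dim_row (V * mat_diag n lam)" "j < dim_col (V * mat_diag n lam)"
    then have aj: "a < n" "j < n" by auto
    have "(A * V) $$ (a, j) = (A *\<^sub>v v j) $ a" using aj by (simp add: col)
    also have "\<dots> = (V * mat_diag n lam) $$ (a, j)"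
      unfolding eigen[OF aj(2)] using aj v[of j]
      by (subst index_mult_mat_diag) (auto simp: V_def)
    finally show "(A * V) $$ (a, j) = (V * mat_diag n lam) $$ (a, j)" .
  qed auto
  then have "A * V * V\<^sup>T = V * mat_diag n lam * V\<^sup>T" by simp
  then show "A = V * mat_diag n lam * V\<^sup>T"
    by (simp add: mult_assoc_dim VV' A)
qed

text \<open>In an orthonormal basis \<open>V\<close> whose first \<open>k\<close> vectors span the column space of \<open>Y\<close>, the
  orthogonal projector \<open>Y Y\<^sup>T\<close> is the coordinate projector.\<close>

lemma projector_in_eigenbasis:
  fixes Y :: "real mat" and v :: "nat \<Rightarrow> real vec"
  assumes k: "k \<le> n" and Y: "Y \<in> Gr_rep n k"
    and v: "\<And>j. j < n \<Longrightarrow> v j \<in> carrier_vec n"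
    and V: "V = mat n n (\<lambda>(a, j). v j $ a)" "V\<^sup>T * V = 1\<^sub>m n"
    and span: "\<And>j. j < k \<Longrightarrow> v j \<in> col_span Y"
  shows "(V\<^sup>T * Y) * (V\<^sup>T * Y)\<^sup>T = mat_diag n (\<lambda>j. if j < k then 1 else 0)"
proof -
  define W where "W = mat n k (\<lambda>(a, j). v j $ a)"
  have [simp]: "dim_row Y = n" "dim_col Y = k" "dim_row V = n" "dim_col V = n" "dim_row W = n" "dim_col W = k"
    using Y V by (auto simp: Gr_rep_def W_def)
  have VW: "(V\<^sup>T * W) $$ (i, j) = (if i = j then 1 else 0)" if "i < n" "j < k" for i j
  proof -
    have "(V\<^sup>T * W) $$ (i, j) = (V\<^sup>T * V) $$ (i, j)"
      using that k by (simp add: index_gram[of _ n] V W_def del: index_mult_mat(1))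
    then show ?thesis using that k by (simp add: V(2))
  qed
  have "(W\<^sup>T * W) $$ (i, j) = (V\<^sup>T * W) $$ (i, j)" if "i < k" "j < k" for i j
    using that k by (simp add: index_gram[of _ n] V W_def del: index_mult_mat(1))
  then have "W\<^sup>T * W = 1\<^sub>m k" using k by (intro eq_matI) (auto simp: VW simp del: index_mult_mat(1))
  then have W: "W \<in> Gr_rep n k" by (simp add: Gr_rep_def W_def)
  have "col W j = v j" if "j < k" for j using v[of j] that k by (auto simp: W_def)
  then have proj: "Y * Y\<^sup>T = W * W\<^sup>T" using span by (intro projector_eq_of_columns_in_span[OF Y W]) simp
  have "(V\<^sup>T * Y) * (V\<^sup>T * Y)\<^sup>T = V\<^sup>T * (Y * Y\<^sup>T) * V" by (simp add: mult_assoc_dim transpose_mult_dim)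
  also have "\<dots> = (V\<^sup>T * W) * (V\<^sup>T * W)\<^sup>T" unfolding proj by (simp add: mult_assoc_dim transpose_mult_dim)
  also have "\<dots> = mat_diag n (\<lambda>j. if j < k then 1 else 0)"
  proof (rule eq_matI)
    fix i j assume "i < dim_row (mat_diag n (\<lambda>j. if j < k then 1 else (0 :: real)))"
      "j < dim_col (mat_diag n (\<lambda>j. if j < k then 1 else (0 :: real)))"
    then have ij: "i < n" "j < n" by auto
    have "((V\<^sup>T * W) * (V\<^sup>T * W)\<^sup>T) $$ (i, j) = (\<Sum>l<k. (V\<^sup>T * W) $$ (i, l) * (V\<^sup>T * W) $$ (j, l))"
      using ij by (subst index_mult_mat_sum) (auto simp del: index_mult_mat(1))
    also have "\<dots> = (\<Sum>l<k. if i = l then (if j = l then 1 else 0) else 0)"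
      using ij by (intro sum.cong) (auto simp: VW simp del: index_mult_mat(1))
    also have "\<dots> = mat_diag n (\<lambda>j. if j < k then 1 else 0) $$ (i, j)"
      using ij by (auto simp: mat_diag_def)
    finally show "((V\<^sup>T * W) * (V\<^sup>T * W)\<^sup>T) $$ (i, j)
      = mat_diag n (\<lambda>j. if j < k then 1 else 0) $$ (i, j)" .
  qed auto
  finally show ?thesis .
qed

text \<open>The estimate \<open>e\<^sub>i \<ge> \<delta> sin\<^sup>2 \<alpha>\<^sub>i\<close> in eigenvector coordinates: \<open>y\<close> is a unit vector in the leading
  eigenspace, and \<open>x\<close> is a unit vector whose projection onto that space is \<open>c y\<close>. The leading part
  contributes \<open>1 - c\<^sup>2\<close> times an average of the first \<open>k\<close> eigenvalues, and the part of \<open>x\<close> of squared length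
  \<open>1 - c\<^sup>2\<close> outside takes away at most \<open>1 - c\<^sup>2\<close> times the next eigenvalue. Indices start at 0, so the gap
  is between \<open>k - 1\<close> and \<open>k\<close>.\<close>

lemma eigenvalue_gap_bound:
  fixes lam x y :: "nat \<Rightarrow> real"
  assumes k: "1 \<le> k" "k < n"
    and lam: "\<And>i j. i \<le> j \<Longrightarrow> j < n \<Longrightarrow> lam j \<le> lam i"
    and y0: "\<And>j. k \<le> j \<Longrightarrow> j < n \<Longrightarrow> y j = 0"
    and x: "\<And>j. j < k \<Longrightarrow> x j = c * y j"
    and x1: "(\<Sum>j<n. (x j)\<^sup>2) = 1" and y1: "(\<Sum>j<n. (y j)\<^sup>2) = 1"
  shows "(1 - c\<^sup>2) * (lam (k - 1) - lam k) \<le> (\<Sum>j<n. lam j * (y j)\<^sup>2) - (\<Sum>j<n. lam j * (x j)\<^sup>2)"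
proof -
  have split: "(\<Sum>j<n. f j) = (\<Sum>j<k. f j) + (\<Sum>j=k..<n. f j)" for f :: "nat \<Rightarrow> real"
    using k by (simp add: sum.atLeastLessThan_concat lessThan_atLeast0)
  have y1': "(\<Sum>j<k. (y j)\<^sup>2) = 1" using y1 by (simp add: split y0)
  have "(\<Sum>j<k. (x j)\<^sup>2) = c\<^sup>2"
    using y1' by (simp add: x power_mult_distrib flip: sum_distrib_left)
  then have x_tail: "(\<Sum>j=k..<n. (x j)\<^sup>2) = 1 - c\<^sup>2" using x1 by (simp add: split)
  then have c: "0 \<le> 1 - c\<^sup>2" by (metis sum_nonneg zero_le_power2)
  have "lam (k - 1) = (\<Sum>j<k. lam (k - 1) * (y j)\<^sup>2)" by (simp add: y1' flip: sum_distrib_left)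
  also have "\<dots> \<le> (\<Sum>j<k. lam j * (y j)\<^sup>2)"
    using k by (intro sum_mono mult_right_mono lam) auto
  finally have lead: "lam (k - 1) \<le> (\<Sum>j<k. lam j * (y j)\<^sup>2)" .
  have "(\<Sum>j=k..<n. lam j * (x j)\<^sup>2) \<le> (\<Sum>j=k..<n. lam k * (x j)\<^sup>2)"
    by (intro sum_mono mult_right_mono lam) auto
  also have "\<dots> = lam k * (1 - c\<^sup>2)" by (simp add: x_tail flip: sum_distrib_left)
  finally have tail: "(\<Sum>j=k..<n. lam j * (x j)\<^sup>2) \<le> lam k * (1 - c\<^sup>2)" .
  have "(\<Sum>j<k. lam j * (x j)\<^sup>2) = c\<^sup>2 * (\<Sum>j<k. lam j * (y j)\<^sup>2)"
    by (simp add: x power_mult_distrib sum_distrib_left mult_ac)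
  then have "(\<Sum>j<n. lam j * (y j)\<^sup>2) - (\<Sum>j<n. lam j * (x j)\<^sup>2)
      = (1 - c\<^sup>2) * (\<Sum>j<k. lam j * (y j)\<^sup>2) - (\<Sum>j=k..<n. lam j * (x j)\<^sup>2)"
    by (simp add: split y0 algebra_simps)
  moreover have "(1 - c\<^sup>2) * lam (k - 1) \<le> (1 - c\<^sup>2) * (\<Sum>j<k. lam j * (y j)\<^sup>2)"
    using lead c by (rule mult_left_mono)
  ultimately show ?thesis using tail by (simp add: algebra_simps)
qed

section \<open>Objective and gradient\<close>

lemma objective_rotate:
  assumes A: "A \<in> carrier_mat n n" and X: "X \<in> carrier_mat n k"
    and Q: "Q \<in> carrier_mat k k" "Q\<^sup>T * Q = 1\<^sub>m k"
  shows "objective A X = - (\<Sum>i<k. ((X * Q)\<^sup>T * A * (X * Q)) $$ (i, i))"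
proof -
  have [simp]: "dim_row X = n" "dim_col X = k" "dim_row Q = k" "dim_col Q = k" "dim_row A = n" "dim_col A = n"
    using assms by auto
  have "mat_trace (X\<^sup>T * A * X) = mat_trace (Q\<^sup>T * (X\<^sup>T * A * X) * Q)"
    by (rule mat_trace_conjugate_orthogonal[symmetric, OF _ Q(1) orthogonal_mat_right_inverse[OF Q]])
      (rule carrier_matI; simp)
  also have "Q\<^sup>T * (X\<^sup>T * A * X) * Q = (X * Q)\<^sup>T * A * (X * Q)"
    by (simp add: mult_assoc_dim transpose_mult_dim)
  finally show ?thesis by (simp add: objective_def mat_trace_def del: index_mult_mat(1))
qed

text \<open>The projector \<open>1 - X X\<^sup>T\<close> in the gradient disappears, since the columns of \<open>R\<close> are already orthogonal
  to \<open>X\<close>, and cyclicity of the trace moves the rotation \<open>Q\<close> to \<open>X\<close>.\<close>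

lemma Gr_inner_grad_objective:
  assumes A: "A \<in> carrier_mat n n" "A\<^sup>T = A" and X: "X \<in> Gr_rep n k"
    and R: "R \<in> carrier_mat n k" and Q: "Q \<in> carrier_mat k k" and XR: "X\<^sup>T * R = 0\<^sub>m k k"
  shows "Gr_inner (grad_objective A X) (- (R * mat_diag k d * Q\<^sup>T))
       = 2 * (\<Sum>i<k. d i * ((X * Q)\<^sup>T * A * R) $$ (i, i))"
proof -
  have [simp]: "dim_row X = n" "dim_col X = k" "dim_row R = n" "dim_col R = k" "dim_row Q = k"
    "dim_col Q = k" "dim_row A = n" "dim_col A = n"
    using A X R Q by (auto simp: Gr_rep_def)
  let ?L = "R * mat_diag k d * Q\<^sup>T" and ?F = "(1\<^sub>m n - X * X\<^sup>T) * A * X"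
  have entry: "(((-2) \<cdot>\<^sub>m ?F)\<^sup>T * (- ?L)) $$ (i, i) = 2 * (?F\<^sup>T * ?L) $$ (i, i)" if "i < k" for i
    using that
    by (simp add: index_gram[of _ n] sum_distrib_left sum_negf mult.assoc del: index_mult_mat(1))
  have "Gr_inner (grad_objective A X) (- ?L) = (\<Sum>i<k. (((-2) \<cdot>\<^sub>m ?F)\<^sup>T * (- ?L)) $$ (i, i))"
    unfolding Gr_inner_def grad_objective_def mat_trace_def by (simp del: index_mult_mat(1))
  also have "\<dots> = (\<Sum>i<k. 2 * (?F\<^sup>T * ?L) $$ (i, i))"
    by (rule sum.cong) (simp_all only: entry lessThan_iff)
  also have "\<dots> = 2 * mat_trace (?F\<^sup>T * ?L)"
    by (simp add: mat_trace_def sum_distrib_left del: index_mult_mat(1))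
  also have "?F\<^sup>T = X\<^sup>T * A * (1\<^sub>m n - X * X\<^sup>T)"
    by (simp add: transpose_mult_dim transpose_minus_dim mult_assoc_dim A(2))
  also have "X\<^sup>T * A * (1\<^sub>m n - X * X\<^sup>T) * ?L = X\<^sup>T * A * ((1\<^sub>m n - X * X\<^sup>T) * R) * mat_diag k d * Q\<^sup>T"
    by (simp add: mult_assoc_dim)
  also have "(1\<^sub>m n - X * X\<^sup>T) * R = R - 0\<^sub>m n k"
    by (simp add: minus_mult_dim mult_assoc_dim XR)
  also have "\<dots> = R" by (rule eq_matI) auto
  also have "mat_trace (X\<^sup>T * A * R * mat_diag k d * Q\<^sup>T) = mat_trace (Q\<^sup>T * (X\<^sup>T * A * R * mat_diag k d))"
    by (rule mat_trace_comm) simp_all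
  also have "Q\<^sup>T * (X\<^sup>T * A * R * mat_diag k d) = (X * Q)\<^sup>T * A * R * mat_diag k d"
    by (simp add: transpose_mult_dim mult_assoc_dim)
  also have "mat_trace \<dots> = (\<Sum>i<k. d i * ((X * Q)\<^sup>T * A * R) $$ (i, i))"
    unfolding mat_trace_def by (simp add: index_mult_mat_diag mult.commute del: index_mult_mat(1))
  finally show ?thesis .
qed

theorem theorem9:
  fixes n k :: nat and A X Y :: "real mat"
    and lam :: "nat \<Rightarrow> real" and v :: "nat \<Rightarrow> real vec" and \<theta> :: "nat \<Rightarrow> real"
  assumes "1 \<le> k" and "k \<le> n - 1"
    and "A \<in> carrier_mat n n" and "A\<^sup>T = A" and "positive_semidefinite A"
    and "\<And>i. i \<in> {1..n} \<Longrightarrow> v i \<in> carrier_vec n"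
    and "\<And>i j. i \<in> {1..n} \<Longrightarrow> j \<in> {1..n} \<Longrightarrow> v i \<bullet> v j = (if i = j then 1 else 0)"
    and "\<And>i. i \<in> {1..n} \<Longrightarrow> A *\<^sub>v v i = lam i \<cdot>\<^sub>v v i"
    and "\<And>i j. i \<in> {1..n} \<Longrightarrow> j \<in> {1..n} \<Longrightarrow> i \<le> j \<Longrightarrow> lam j \<le> lam i"
    and "X \<in> Gr_rep n k"
    and "Y \<in> Gr_rep n k" and "col_span Y = vec_span n (v ` {1..k})"
    and "principal_angles X Y \<theta>" and "\<theta> k < pi / 2"
  defines "fstar \<equiv> - (\<Sum>i=1..k. lam i)"
    and "a \<equiv> over_tan (\<theta> k)"
    and "c\<^sub>Q \<equiv> 4 / pi\<^sup>2"
    and "\<delta> \<equiv> lam k - lam (k + 1)"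
  shows "objective A X - fstar
           \<le> 1 / a * Gr_inner (grad_objective A X) (- Gr_Log X Y) - c\<^sub>Q * \<delta> * (Gr_dist X Y)\<^sup>2
         \<and> a > 0 \<and> c\<^sub>Q > 0.4 \<and> \<delta> \<ge> 0"
proof -
  note k = assms(1,2) and A = assms(3,4) and v = assms(6) and orth = assms(7) and eigen = assms(8)
    and lam_mono = assms(9) and X = assms(10) and Y = assms(11) and span = assms(12)
    and angles = assms(13) and angle_k = assms(14)
  have kn: "k < n" using k by simp
  have XX: "X \<in> carrier_mat n k" "X\<^sup>T * X = 1\<^sub>m k" and YY: "Y \<in> carrier_mat n k" "Y\<^sup>T * Y = 1\<^sub>m k"
    using X Y by (auto simp: Gr_rep_def)
  define \<alpha> where "\<alpha> i = \<theta> (Suc i)" for i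
  define l where "l j = lam (Suc j)" for j
  have dimX: "dim_col X = k" using XX by simp
  obtain P Q where svd: "is_svd k (Y\<^sup>T * X) P (\<lambda>i. cos (\<alpha> i)) Q"
    using angles by (auto simp: principal_angles_def \<alpha>_def dimX)
  have \<theta>: "0 \<le> \<theta> i" "\<theta> i \<le> \<theta> k" if "i \<in> {1..k}" for i
    using angles that by (auto simp: principal_angles_def dimX)
  have \<alpha>: "0 \<le> \<alpha> i \<and> \<alpha> i < pi / 2" "\<alpha> i \<le> \<theta> k" if "i < k" for i
    using \<theta>[of "Suc i"] angle_k that by (auto simp: \<alpha>_def)
  have P: "P \<in> carrier_mat k k" "P\<^sup>T * P = 1\<^sub>m k" and Q: "Q \<in> carrier_mat k k" "Q\<^sup>T * Q = 1\<^sub>m k"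
    and YX: "Y\<^sup>T * X = P * mat_diag k (\<lambda>i. cos (\<alpha> i)) * Q\<^sup>T"
    using svd XX YY by (auto simp: is_svd_def)
  define R where "R = Y * P * mat_diag k (\<lambda>i. 1 / cos (\<alpha> i)) - X * Q"
  have XR: "X\<^sup>T * R = 0\<^sub>m k k"
    and Log: "Gr_Log X Y = R * mat_diag k (\<lambda>i. over_tan (\<alpha> i)) * Q\<^sup>T"
    unfolding R_def using \<alpha>(1) by (intro Gr_Log_principal_vectors[OF X Y svd]; simp)+
  define V where "V = mat n n (\<lambda>(a, j). v (Suc j) $ a)"
  have [simp]: "dim_row X = n" "dim_col X = k" "dim_row Y = n" "dim_col Y = k" "dim_row P = k"
    "dim_col P = k" "dim_row Q = k" "dim_col Q = k" "dim_row V = n" "dim_col V = n" "dim_row R = n" "dim_col R = k"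
    using XX YY P Q by (auto simp: V_def R_def)
  have VV: "V\<^sup>T * V = 1\<^sub>m n" "V * V\<^sup>T = 1\<^sub>m n" and A_eq: "A = V * mat_diag n l * V\<^sup>T"
    using spectral_decomposition[of A n "\<lambda>j. v (Suc j)" l] A v orth eigen
    by (simp_all add: V_def l_def)
  \<comment> \<open>The principal vectors in eigenvector coordinates, where \<open>A\<close> is diagonal.\<close>
  define G where "G = V\<^sup>T * (X * Q)"
  define H where "H = V\<^sup>T * (Y * P)"
  have [simp]: "dim_row G = n" "dim_col G = k" "dim_row H = n" "dim_col H = k" by (simp_all add: G_def H_def)
  have VVc: "V * (V\<^sup>T * B) = B" if "dim_row B = n" for B
    using that by (simp add: VV flip: mult_assoc_dim)
  have Pc: "P\<^sup>T * (P * B) = B" "Q\<^sup>T * (Q * B) = B" "P * (P\<^sup>T * B) = B" "Q * (Q\<^sup>T * B) = B"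
     "X\<^sup>T * (X * B) = B" "Y\<^sup>T * (Y * B) = B"
     "Y\<^sup>T * (X * B) = P * (mat_diag k (\<lambda>i. cos (\<alpha> i)) * (Q\<^sup>T * B))" if "dim_row B = k" for B
    using that by (simp_all add: P(2) Q(2) XX(2) YY(2) YX orthogonal_mat_right_inverse[OF P]
      orthogonal_mat_right_inverse[OF Q] mult_assoc_dim[symmetric])
  have "V\<^sup>T * Y * (V\<^sup>T * Y)\<^sup>T = mat_diag n (\<lambda>j. if j < k then 1 else 0)"
  proof (rule projector_in_eigenbasis[OF _ Y _ V_def VV(1)])
    fix j assume "j < k"
    have "v ` {1..k} \<subseteq> col_span Y"
      unfolding span using v kn by (intro vec_span_superset) auto
    then show "v (Suc j) \<in> col_span Y" using \<open>j < k\<close> by auto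
  qed (use kn v in auto)
  then have HH: "H * H\<^sup>T = mat_diag n (\<lambda>j. if j < k then 1 else 0)"
    by (simp add: H_def mult_assoc_dim transpose_mult_dim Pc)
  have GG1: "G\<^sup>T * G = 1\<^sub>m k" and HH1: "H\<^sup>T * H = 1\<^sub>m k"
    and HG: "H\<^sup>T * G = mat_diag k (\<lambda>i. cos (\<alpha> i))"
    by (simp_all add: G_def H_def mult_assoc_dim transpose_mult_dim VVc Pc P Q)
  have H_row: "(\<Sum>i<k. (H $$ (j, i))\<^sup>2) = (if j < k then 1 else 0)" if "j < n" for j
  proof -
    have "(\<Sum>i<k. (H $$ (j, i))\<^sup>2) = (H * H\<^sup>T) $$ (j, j)"
      using that by (subst index_mult_mat_sum) (auto simp: power2_eq_square)
    then show ?thesis using that unfolding HH by (simp add: mat_diag_def)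
  qed
  \<comment> \<open>A vanishing row sum of squares: principal vectors of \<open>Y\<close> lie in the leading eigenspace.\<close>
  have H_zero: "H $$ (j, i) = 0" if "k \<le> j" "j < n" "i < k" for i j
  proof -
    have "(\<Sum>i<k. (H $$ (j, i))\<^sup>2) = 0" using H_row[of j] that by simp
    then have "(H $$ (j, i))\<^sup>2 = 0" by (rule sum_nonneg_0[of "{..<k}", rotated 2]) (use that in auto)
    then show ?thesis by simp
  qed
  \<comment> \<open>\<open>H H\<^sup>T\<close> projects onto the leading coordinates, and it maps \<open>G\<close> to \<open>H (diag cos \<alpha>)\<close>.\<close>
  have G_lead: "G $$ (j, i) = cos (\<alpha> i) * H $$ (j, i)" if "j < k" "i < k" for i j
  proof -
    have "H * mat_diag k (\<lambda>i. cos (\<alpha> i)) = H * H\<^sup>T * G" by (simp add: mult_assoc_dim flip: HG)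
    then have "(H * mat_diag k (\<lambda>i. cos (\<alpha> i))) $$ (j, i)
        = (mat_diag n (\<lambda>j. if j < k then 1 else 0) * G) $$ (j, i)"
      unfolding HH by simp
    then show ?thesis using that kn
      by (simp add: index_mult_mat_diag index_mat_diag_mult mult.commute del: index_mult_mat(1))
  qed
  have G_col: "(\<Sum>j<n. (G $$ (j, i))\<^sup>2) = 1" and H_col: "(\<Sum>j<n. (H $$ (j, i))\<^sup>2) = 1" if "i < k" for i
  proof -
    have "(G\<^sup>T * G) $$ (i, i) = 1" "(H\<^sup>T * H) $$ (i, i) = 1" unfolding GG1 HH1 using that by auto
    then show "(\<Sum>j<n. (G $$ (j, i))\<^sup>2) = 1" "(\<Sum>j<n. (H $$ (j, i))\<^sup>2) = 1"
      using that by (simp_all add: index_gram[of _ n] power2_eq_square del: index_mult_mat(1))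
  qed
  define b where "b i = (\<Sum>j<n. l j * (H $$ (j, i))\<^sup>2)" for i
  define g where "g i = (\<Sum>j<n. l j * (G $$ (j, i))\<^sup>2)" for i
  have l_mono: "l j \<le> l i" if "i \<le> j" "j < n" for i j
    using lam_mono[of "Suc i" "Suc j"] that by (auto simp: l_def)
  have \<delta>_eq: "\<delta> = l (k - 1) - l k" using k by (simp add: \<delta>_def l_def)
  then have \<delta>_nonneg: "0 \<le> \<delta>" using l_mono[of "k - 1" k] kn by simp
  have gap: "(sin (\<alpha> i))\<^sup>2 * \<delta> \<le> b i - g i" if "i < k" for i
    unfolding \<delta>_eq b_def g_def sin_squared_eq
    by (rule eigenvalue_gap_bound[OF k(1) kn]) (use that l_mono H_zero G_lead G_col H_col in auto)
  have A_quad: "M\<^sup>T * A * N = (V\<^sup>T * M)\<^sup>T * mat_diag n l * (V\<^sup>T * N)"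
    if "dim_row M = n" "dim_row N = n" for M N
    using that by (simp add: A_eq mult_assoc_dim transpose_mult_dim)
  have XAX: "((X * Q)\<^sup>T * A * (X * Q)) $$ (i, i) = g i" if "i < k" for i
    using that
    by (simp add: A_quad index_diag_form[of _ n] g_def power2_eq_square flip: G_def
      del: index_mult_mat(1))
  have XAY: "((X * Q)\<^sup>T * A * (Y * P)) $$ (i, i) = cos (\<alpha> i) * b i" if "i < k" for i
  proof -
    have "((X * Q)\<^sup>T * A * (Y * P)) $$ (i, i) = (\<Sum>j<n. l j * (G $$ (j, i) * H $$ (j, i)))"
      using that by (simp add: A_quad index_diag_form[of _ n] flip: G_def H_def del: index_mult_mat(1))
    also have "\<dots> = (\<Sum>j<n. cos (\<alpha> i) * (l j * (H $$ (j, i))\<^sup>2))"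
    proof (rule sum.cong)
      fix j assume "j \<in> {..<n}"
      then show "l j * (G $$ (j, i) * H $$ (j, i)) = cos (\<alpha> i) * (l j * (H $$ (j, i))\<^sup>2)"
        using G_lead[of j i] H_zero[of j i] that by (cases "j < k") (auto simp: power2_eq_square)
    qed simp
    finally show ?thesis by (simp add: b_def sum_distrib_left)
  qed
  have [simp]: "dim_row A = n" "dim_col A = n" using A by auto
  have XAR: "((X * Q)\<^sup>T * A * R) $$ (i, i) = b i - g i" if "i < k" for i
  proof -
    have "cos (\<alpha> i) \<noteq> 0" using \<alpha>[OF that] cos_gt_zero_pi[of "\<alpha> i"] by force
    moreover have "(X * Q)\<^sup>T * A * R =
        (X * Q)\<^sup>T * A * (Y * P) * mat_diag k (\<lambda>i. 1 / cos (\<alpha> i)) - (X * Q)\<^sup>T * A * (X * Q)"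
      by (simp add: R_def mult_minus_dim mult_assoc_dim)
    ultimately show ?thesis
      using that by (simp add: index_mult_mat_diag XAX XAY del: index_mult_mat(1))
  qed
  have inner: "Gr_inner (grad_objective A X) (- Gr_Log X Y) = 2 * (\<Sum>i<k. over_tan (\<alpha> i) * (b i - g i))"
  proof -
    have "R \<in> carrier_mat n k" by (rule carrier_matI) simp_all
    from Gr_inner_grad_objective[OF A X this Q(1) XR] show ?thesis
      unfolding Log by (simp add: XAR del: index_mult_mat(1))
  qed
  have "(\<Sum>i<k. b i) = (\<Sum>j<n. l j * (\<Sum>i<k. (H $$ (j, i))\<^sup>2))"
    unfolding b_def by (subst sum.swap) (simp add: sum_distrib_left)
  also have "\<dots> = (\<Sum>j<n. if j < k then l j else 0)"
    by (intro sum.cong) (auto simp: H_row)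
  also have "\<dots> = (\<Sum>j<k. l j)"
    using kn by (intro sum.mono_neutral_cong_right) auto
  also have "\<dots> = - fstar" by (simp add: fstar_def l_def sum.atLeast1_atMost_eq)
  finally have fstar: "- fstar = (\<Sum>i<k. b i)" by simp
  have "objective A X = - (\<Sum>i<k. g i)"
    unfolding objective_rotate[OF A(1) XX(1) Q] by (simp add: XAX del: index_mult_mat(1))
  then have f_gap: "objective A X - fstar = (\<Sum>i<k. b i - g i)"
    using fstar by (simp add: sum_subtractf)
  have a_pos: "0 < a" unfolding a_def using \<theta>[of k] k angle_k by (intro over_tan_pos) auto
  have e_nonneg: "0 \<le> b i - g i" if "i < k" for i
    using gap[OF that] \<delta>_nonneg by (meson mult_nonneg_nonneg order_trans zero_le_power2)
  have "a * (\<Sum>i<k. b i - g i) \<le> (\<Sum>i<k. over_tan (\<alpha> i) * (b i - g i))"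
    unfolding sum_distrib_left a_def
    using e_nonneg \<alpha> angle_k by (intro sum_mono mult_right_mono over_tan_antimono) auto
  then have quasi: "2 * (objective A X - fstar) \<le> 1 / a * Gr_inner (grad_objective A X) (- Gr_Log X Y)"
    unfolding inner f_gap using a_pos by (simp add: field_simps)
  have "c\<^sub>Q * \<delta> * (Gr_dist X Y)\<^sup>2 = (\<Sum>i<k. (2 / pi * \<alpha> i)\<^sup>2 * \<delta>)"
    unfolding Gr_dist_squared[OF XX(1) YY(1) angles] c\<^sub>Q_def
    by (simp add: sum.atLeast1_atMost_eq \<alpha>_def sum_distrib_left sum_divide_distrib
      power_mult_distrib power_divide mult_ac)
  also have "\<dots> \<le> (\<Sum>i<k. (sin (\<alpha> i))\<^sup>2 * \<delta>)"
    using \<alpha> \<delta>_nonneg by (intro sum_mono mult_right_mono power_mono sin_ge_linear) (auto intro: less_imp_le)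
  also have "\<dots> \<le> objective A X - fstar"
    unfolding f_gap by (intro sum_mono gap) auto
  finally have growth: "c\<^sub>Q * \<delta> * (Gr_dist X Y)\<^sup>2 \<le> objective A X - fstar" .
  have "0.4 < c\<^sub>Q"
    unfolding c\<^sub>Q_def using pi_squared_less_10 by (simp add: field_simps)
  moreover have "x \<le> p - q" if "2 * x \<le> p" "q \<le> x" for x p q :: real
    using that by linarith
  note this[OF quasi growth]
  ultimately show ?thesis using a_pos \<delta>_nonneg by blast
qed

end
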